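(* Let $G$ be a connected graph of order $n\ge 2$. Then $sn(G)=1$ if and only if $G$ is a bipartite graph.
   Context: Graphs are finite, undirected, simple and connected. Let $G=(V,E)$ be a graph with chromatic number $\chi(G)=k\ge 2$. For $S\subset V$, a partial coloring on $G[S]$ is a proper coloring $\mathscr C_0$ of the induced subgraph $G[S]$ with colors from $\{1,\dots,k\}$ (not all colors need be used). It is a Sudoku coloring of $G$ if there is exactly one proper $k$-coloring $V\to\{1,\dots,k\}$ of $G$ whose restriction to $S$ is $\mathscr C_0$. The Sudoku number $sn(G)$ is the smallest $|S|$ such that $G[S]$ admits a Sudoku coloring of $G$. *)

theory Defs
  imports "HOL-Library.FuncSet" "Graph_Theory.Digraph_Component"
begin

text \<open>
  Finite simple undirected graphs are the symmetric, loop-free digraphs without parallel arcs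
  of the locale \<^locale>\<open>graph\<close>; an undirected edge is a pair of opposite arcs.

  Colorings are extensional functions (\<open>undefined\<close> outside the vertex set), so that equality of
  functions is equality of colorings and "exactly one coloring" can be stated with \<open>\<exists>!\<close>.
\<close>

definition proper_coloring :: "('a, 'b) pre_digraph \<Rightarrow> nat \<Rightarrow> ('a \<Rightarrow> nat) \<Rightarrow> bool" where
  "proper_coloring G k c \<longleftrightarrow>
     c \<in> verts G \<rightarrow>\<^sub>E {1..k} \<and> (\<forall>u v. u \<rightarrow>\<^bsub>G\<^esub> v \<longrightarrow> c u \<noteq> c v)"

definition chromatic_number :: "('a, 'b) pre_digraph \<Rightarrow> nat" where
  "chromatic_number G = (LEAST k. \<exists>c. proper_coloring G k c)"

definition sudoku_coloring :: "('a, 'b) pre_digraph \<Rightarrow> 'a set \<Rightarrow> ('a \<Rightarrow> nat) \<Rightarrow> bool" where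
  "sudoku_coloring G S c0 \<longleftrightarrow>
     S \<subseteq> verts G \<and>
     proper_coloring (G \<restriction> S) (chromatic_number G) c0 \<and>
     (\<exists>!c. proper_coloring G (chromatic_number G) c \<and> restrict c S = c0)"

text \<open>
  For finite loop-free \<open>G\<close> both minima are over nonempty sets: a coloring with pairwise
  distinct colors is proper, and \<open>S = verts G\<close> with any proper coloring is Sudoku.
\<close>

definition sudoku_number :: "('a, 'b) pre_digraph \<Rightarrow> nat" where
  "sudoku_number G = (LEAST m. \<exists>S c0. card S = m \<and> sudoku_coloring G S c0)"

definition bipartite :: "('a, 'b) pre_digraph \<Rightarrow> bool" where
  "bipartite G \<longleftrightarrow>
     (\<exists>A B. A \<union> B = verts G \<and> A \<inter> B = {} \<and>
        (\<forall>u v. u \<rightarrow>\<^bsub>G\<^esub> v \<longrightarrow> u \<in> A \<and> v \<in> B \<or> u \<in> B \<and> v \<in> A))"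

end

theory Submission
  imports Defs "HOL-Combinatorics.Permutations"
begin

text \<open>
  A Sudoku coloring on \<open>S\<close> leaves at most one of the \<open>\<chi>(G)\<close> colors unused on \<open>S\<close>: otherwise,
  interchanging two colors unused on \<open>S\<close> preserves the unique extension, which therefore uses
  neither of them and is not an optimal coloring. Hence \<open>\<chi>(G) \<le> |S| + 1\<close>, and
  \<open>sn(G) = 1\<close> forces \<open>\<chi>(G) \<le> 2\<close>. Conversely, a 2-coloring of a connected graph is determined by
  its value at any single vertex, whereas the empty set determines nothing.
\<close>

text \<open>Injectivity of \<open>\<pi>\<close> preserves properness, and \<open>restrict\<close>
  makes the composite extensional again, as \<open>proper_coloring\<close> requires. It is used
  below for transpositions of two colors.\<close>

lemma proper_coloring_comp_permutes:
  assumes "wf_digraph G" "proper_coloring G k c" "\<pi> permutes {1..k}"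
  shows "proper_coloring G k (restrict (\<pi> \<circ> c) (verts G))"
proof -
  interpret wf_digraph G by fact
  have "c \<in> verts G \<rightarrow>\<^sub>E {1..k}" "\<And>u v. u \<rightarrow>\<^bsub>G\<^esub> v \<Longrightarrow> c u \<noteq> c v"
    using assms(2) by (auto simp: proper_coloring_def)
  moreover have "\<pi> i \<in> {1..k} \<longleftrightarrow> i \<in> {1..k}" for i
    by (rule permutes_in_image[OF assms(3)])
  moreover have "inj \<pi>" using assms(3) by (rule permutes_inj)
  ultimately show ?thesis
    unfolding proper_coloring_def
    by (auto simp: PiE_iff dest: adj_in_verts injD)
qed

lemma proper_coloring_restrict:
  assumes "proper_coloring G k c" "S \<subseteq> verts G"
  shows "proper_coloring (G \<restriction> S) k (restrict c S)"
  using assms unfolding proper_coloring_def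
  by (auto simp: arcs_ends_conv PiE_iff subset_iff)

lemma proper_coloring_exists:
  assumes "finite (verts G)" "loopfree_digraph G"
  shows "\<exists>k c. proper_coloring G k c"
proof -
  interpret loopfree_digraph G by fact
  \<comment> \<open>Numbering the vertices from 1 gives pairwise distinct colors; loop-freeness
    turns distinct vertices into distinct colors along arcs.\<close>
  have "card (verts G) = card {1..card (verts G)}" by simp
  then obtain f where f: "bij_betw f (verts G) {1..card (verts G)}"
    using finite_same_card_bij[OF assms(1) finite_atLeastAtMost] by blast
  have "f u \<noteq> f v" if "u \<rightarrow>\<^bsub>G\<^esub> v" for u v
    using that f adj_not_same adj_in_verts[OF that] by (auto simp: bij_betw_def inj_on_def)
  then have "proper_coloring G (card (verts G)) (restrict f (verts G))"
    using f unfolding proper_coloring_def by (auto simp: bij_betw_def dest: adj_in_verts)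
  then show ?thesis by blast
qed

lemma proper_coloring_chromatic_number:
  assumes "finite (verts G)" "loopfree_digraph G"
  shows "\<exists>c. proper_coloring G (chromatic_number G) c"
  unfolding chromatic_number_def using LeastI_ex[OF proper_coloring_exists[OF assms]] .

lemma chromatic_number_le: "proper_coloring G k c \<Longrightarrow> chromatic_number G \<le> k"
  unfolding chromatic_number_def by (rule Least_le) blast

lemma two_le_chromatic_number:
  assumes "finite (verts G)" "loopfree_digraph G" "u \<rightarrow>\<^bsub>G\<^esub> v"
  shows "2 \<le> chromatic_number G"
proof -
  interpret loopfree_digraph G by fact
  obtain c where c: "proper_coloring G (chromatic_number G) c"
    using proper_coloring_chromatic_number[OF assms(1,2)] by blast
  have "u \<in> verts G" "v \<in> verts G" using assms(3) by (auto dest: adj_in_verts)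
  then have "c u \<in> {1..chromatic_number G}" "c v \<in> {1..chromatic_number G}" "c u \<noteq> c v"
    using c assms(3) by (auto simp: proper_coloring_def)
  then show ?thesis by auto
qed

lemma proper_coloring_chromatic_number_surj:
  assumes "wf_digraph G" "proper_coloring G (chromatic_number G) c" "a \<in> {1..chromatic_number G}"
  shows "a \<in> c ` verts G"
proof (rule ccontr)
  define k where "k = chromatic_number G"
  assume a: "a \<notin> c ` verts G"
  have k: "a \<in> {1..k}" "k \<in> {1..k}" using assms(3) by (auto simp: k_def)
  define d where "d = restrict (transpose a k \<circ> c) (verts G)"
  have "proper_coloring G k d"
    unfolding d_def using assms(1,2) k
    by (intro proper_coloring_comp_permutes) (auto simp: k_def intro: permutes_swap_id)
  moreover have "d u \<noteq> k" if "u \<in> verts G" for u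
    using a that by (auto simp: d_def transpose_def)
  ultimately have "proper_coloring G (k - 1) d"
    unfolding proper_coloring_def by (fastforce simp: PiE_iff)
  \<comment> \<open>Since \<open>a\<close> lies in \<open>{1..k}\<close>, \<open>k\<close> is
    positive, so \<open>k - 1\<close> is strictly smaller than \<open>k\<close>.\<close>
  from chromatic_number_le[OF this] show False using k by (simp add: k_def)
qed

lemma chromatic_number_le_sudoku:
  assumes "wf_digraph G" "finite (verts G)" "sudoku_coloring G S c0"
  shows "chromatic_number G \<le> card S + 1"
proof (rule ccontr)
  define k where "k = chromatic_number G"
  assume "\<not> ?thesis"
  then have less: "card S + 1 < k" by (simp add: k_def)
  have S: "S \<subseteq> verts G" using assms(3) by (simp add: sudoku_coloring_def)
  have ex1: "\<exists>!c. proper_coloring G k c \<and> restrict c S = c0"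
    using assms(3) by (simp add: sudoku_coloring_def k_def)
  then obtain c where c: "proper_coloring G k c" "restrict c S = c0" by blast
  have "finite S" using S assms(2) finite_subset by blast
  then have "card (c ` S) \<le> card S" by (rule card_image_le)
  moreover have "card {1..k} - card (c ` S) \<le> card ({1..k} - c ` S)"
    using \<open>finite S\<close> by (intro diff_card_le_card_Diff) auto
  \<comment> \<open>At most \<open>card S\<close> colors occur on \<open>S\<close>, and
    \<open>card S \<le> k - 2\<close>, so two colors remain to be interchanged.\<close>
  ultimately have "2 \<le> card ({1..k} - c ` S)" using less by simp
  then obtain a b where ab: "a \<in> {1..k} - c ` S" "b \<in> {1..k} - c ` S" "a \<noteq> b"
    by (metis card_2_iff obtain_subset_with_card_n insert_subset)
  define d where "d = restrict (transpose a b \<circ> c) (verts G)"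
  have "proper_coloring G k d"
    unfolding d_def using assms(1) c ab
    by (intro proper_coloring_comp_permutes) (auto intro: permutes_swap_id)
  moreover have "restrict d S = restrict c S"
    using S ab by (intro restrict_ext) (auto simp: d_def transpose_def)
  ultimately have "d = c" using ex1 c by auto
  \<comment> \<open>The interchange changes \<open>c\<close>: by optimality the color
    \<open>a\<close> occurs at some vertex, necessarily outside \<open>S\<close>.\<close>
  obtain u where u: "u \<in> verts G" "c u = a"
    using proper_coloring_chromatic_number_surj[OF assms(1), of c a] c ab by (auto simp: k_def)
  then have "d u = b" by (simp add: d_def)
  with u \<open>d = c\<close> ab show False by simp
qed

lemma sudoku_coloring_verts:
  assumes "wf_digraph G" "proper_coloring G (chromatic_number G) c"
  shows "sudoku_coloring G (verts G) c"
proof -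
  have ext: "restrict d (verts G) = d" if "proper_coloring G (chromatic_number G) d" for d
    using that by (auto simp: proper_coloring_def PiE_restrict)
  show ?thesis
    using proper_coloring_restrict[OF assms(2) order_refl] assms(2) ext
    unfolding sudoku_coloring_def by auto
qed

text \<open>The full vertex set with an optimal coloring is a candidate, so the \<open>LEAST\<close>
  in \<open>sudoku_number\<close> is a genuine minimum.\<close>

lemma sudoku_number_attained:
  assumes "finite (verts G)" "loopfree_digraph G"
  shows "\<exists>S c0. card S = sudoku_number G \<and> sudoku_coloring G S c0"
proof -
  interpret loopfree_digraph G by fact
  have "\<exists>m S c0. card S = m \<and> sudoku_coloring G S c0"
    using proper_coloring_chromatic_number[OF assms] sudoku_coloring_verts wf_digraph_axioms
    by blast
  then show ?thesis unfolding sudoku_number_def by (rule LeastI_ex)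
qed

lemma sudoku_number_le: "sudoku_coloring G S c0 \<Longrightarrow> sudoku_number G \<le> card S"
  unfolding sudoku_number_def by (rule Least_le) blast

lemma bipartite_iff_2_coloring:
  fixes G :: "('a, 'b) pre_digraph"
  assumes "wf_digraph G"
  shows "bipartite G \<longleftrightarrow> (\<exists>c. proper_coloring G 2 c)"
proof
  interpret wf_digraph G by fact
  assume "bipartite G"
  then obtain A B where AB: "A \<union> B = verts G" "A \<inter> B = {}"
    "\<And>u v. u \<rightarrow>\<^bsub>G\<^esub> v \<Longrightarrow> u \<in> A \<and> v \<in> B \<or> u \<in> B \<and> v \<in> A"
    unfolding bipartite_def by blast
  define c where "c = (\<lambda>v\<in>verts G. if v \<in> A then 1 else 2 :: nat)"
  have "c u \<noteq> c v" if "u \<rightarrow>\<^bsub>G\<^esub> v" for u v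
    using AB(1,2) AB(3)[OF that] by (auto simp: c_def)
  then have "proper_coloring G 2 c"
    unfolding proper_coloring_def by (auto simp: c_def)
  then show "\<exists>c. proper_coloring G 2 c" by blast
next
  interpret wf_digraph G by fact
  assume "\<exists>c. proper_coloring G 2 c"
  then obtain c :: "'a \<Rightarrow> nat" where c: "c \<in> verts G \<rightarrow>\<^sub>E {1..2}" "\<And>u v. u \<rightarrow>\<^bsub>G\<^esub> v \<Longrightarrow> c u \<noteq> c v"
    unfolding proper_coloring_def by blast
  have two: "c u = 1 \<or> c u = 2" if "u \<in> verts G" for u
    using PiE_mem[OF c(1) that] by auto
  show "bipartite G"
    unfolding bipartite_def
  proof (intro exI conjI allI impI)
    show "{u \<in> verts G. c u = 1} \<union> {u \<in> verts G. c u = 2} = verts G" using two by auto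
    show "{u \<in> verts G. c u = 1} \<inter> {u \<in> verts G. c u = 2} = {}" by auto
    fix u v assume uv: "u \<rightarrow>\<^bsub>G\<^esub> v"
    show "u \<in> {u \<in> verts G. c u = 1} \<and> v \<in> {u \<in> verts G. c u = 2} \<or>
          u \<in> {u \<in> verts G. c u = 2} \<and> v \<in> {u \<in> verts G. c u = 1}"
      using adj_in_verts[OF uv] two[of u] two[of v] c(2)[OF uv] by auto
  qed
qed

text \<open>With two colors, the color of a vertex forces that of each neighbor, so agreement at
  \<open>w\<close> propagates along paths to every vertex.\<close>

lemma two_coloring_unique:
  assumes "strongly_connected G" "proper_coloring G 2 c" "proper_coloring G 2 d"
    and "w \<in> verts G" "c w = d w" "wf_digraph G"
  shows "c = d"
proof
  interpret wf_digraph G by fact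
  have two: "f u = 1 \<or> f u = 2" if "proper_coloring G 2 f" "u \<in> verts G" for f u
  proof -
    have "f u \<in> {1..2}" using that unfolding proper_coloring_def by (blast dest: PiE_mem)
    then show ?thesis by auto
  qed
  have ne: "f u \<noteq> f v" if "proper_coloring G 2 f" "u \<rightarrow>\<^bsub>G\<^esub> v" for f u v
    using that by (auto simp: proper_coloring_def)
  fix v
  show "c v = d v"
  proof (cases "v \<in> verts G")
    case True
    then have "w \<rightarrow>\<^sup>*\<^bsub>G\<^esub> v" using assms(1,4) by (auto simp: strongly_connected_def)
    then show ?thesis
    proof (induction rule: reachable_induct)
      case base
      then show ?case using assms(5) by simp
    next
      case (step x y)
      have "x \<in> verts G" "y \<in> verts G" using step.hyps(2) by (auto dest: adj_in_verts)
      note xy = this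
      have "c x \<noteq> c y" "d x \<noteq> d y"
        using ne[OF assms(2) step.hyps(2)] ne[OF assms(3) step.hyps(2)] .
      moreover have "c x = 1 \<or> c x = 2" "c y = 1 \<or> c y = 2" "d y = 1 \<or> d y = 2"
        using two[OF assms(2) xy(1)] two[OF assms(2) xy(2)] two[OF assms(3) xy(2)] .
      \<comment> \<open>As \<open>c x = d x\<close>, both \<open>c y\<close> and \<open>d y\<close>
        are the one color of \<open>{1, 2}\<close> different from it.\<close>
      ultimately show ?case using step.IH by linarith
    qed
  next
    case False
    \<comment> \<open>Off the vertex set, equality holds because colorings are extensional.\<close>
    have "f v = undefined" if "proper_coloring G 2 f" for f
      using that False unfolding proper_coloring_def by (blast dest: PiE_arb)
    from this[OF assms(2)] this[OF assms(3)] show ?thesis by simp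
  qed
qed

theorem theorem3p1:
  fixes G :: "('a, 'b) pre_digraph"
  assumes "graph G"
    and "connected G"
    and "card (verts G) \<ge> 2"
  shows "sudoku_number G = 1 \<longleftrightarrow> bipartite G"
proof -
  interpret graph G by fact
  have wf: "wf_digraph G" and lf: "loopfree_digraph G" and fin: "finite (verts G)"
    by unfold_locales simp
  have sc: "strongly_connected G"
    using symmetric_connected_imp_strongly_connected[OF sym_arcs assms(2)] .
  obtain w w' where w: "w \<in> verts G" "w' \<in> verts G" "w \<noteq> w'"
    using assms(3) by (metis card_2_iff obtain_subset_with_card_n insert_subset)
  then have "w \<rightarrow>\<^sup>*\<^bsub>G\<^esub> w'" using sc by (auto simp: strongly_connected_def)
  \<comment> \<open>The first arc of a path from \<open>w\<close> to a different vertex; a single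
    arc already excludes fewer than two colors.\<close>
  then obtain x where edge: "w \<rightarrow>\<^bsub>G\<^esub> x"
    using w(3) by (cases rule: converse_reachable_cases) auto
  have ge2: "2 \<le> chromatic_number G" by (rule two_le_chromatic_number[OF fin lf edge])
  obtain S c0 where S: "card S = sudoku_number G" "sudoku_coloring G S c0"
    using sudoku_number_attained[OF fin lf] by blast
  \<comment> \<open>This bound serves both directions: it gives at most two colors when the Sudoku
    number is 1, and together with \<open>ge2\<close> it excludes Sudoku number 0.\<close>
  have le: "chromatic_number G \<le> sudoku_number G + 1"
    using chromatic_number_le_sudoku[OF wf fin S(2)] S(1) by simp
  show ?thesis
  proof
    assume "sudoku_number G = 1"
    then have "chromatic_number G = 2" using le ge2 by simp
    then show "bipartite G"
      using proper_coloring_chromatic_number[OF fin lf] bipartite_iff_2_coloring[OF wf] by simp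
  next
    assume "bipartite G"
    then obtain c where c: "proper_coloring G 2 c" using bipartite_iff_2_coloring[OF wf] by blast
    have k: "chromatic_number G = 2" using chromatic_number_le[OF c] ge2 by simp
    \<comment> \<open>Evaluating the equal restrictions at \<open>w\<close> gives the common value
      from which the 2-coloring is determined.\<close>
    have "d = c" if "proper_coloring G 2 d" "restrict d {w} = restrict c {w}" for d
      using two_coloring_unique[OF sc that(1) c w(1) _ wf] fun_cong[OF that(2), of w] by simp
    then have "sudoku_coloring G {w} (restrict c {w})"
      using c w(1) proper_coloring_restrict[OF c, of "{w}"]
      unfolding sudoku_coloring_def k by auto
    from sudoku_number_le[OF this] show "sudoku_number G = 1" using le ge2 by simp
  qed
qed

end
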